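(* Let $q,a$ be complex numbers with $|q|<1$ and $aq^{2i+1}\neq 1$ for all integers $i\ge 0$. Then $$\sum_{r=0}^\infty \sum_{s=0}^\infty \frac{a^{r+2s}\, q^{2(r+s)^2 + 2s^2}}{(q^2;q^2)_{r}\, (q^2;q^2)_{s}} = (aq;q^2)_\infty \sum_{j=0}^\infty \frac{ a^j q^{j^2} }{ (aq;q^2)_{j}\, (q;q)_j}.$$
   Context: For complex $A$ and base $p$ with $|p|<1$: $(A;p)_m=\prod_{i=0}^{m-1}(1-Ap^i)$ for integers $m\ge0$ (so $(A;p)_0=1$), and $(A;p)_\infty=\prod_{i=0}^{\infty}(1-Ap^i)$. *)

theory Defs
  imports "HOL-Analysis.Analysis"
begin

definition qpoch :: "complex \<Rightarrow> complex \<Rightarrow> nat \<Rightarrow> complex" where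
  "qpoch A p m = (\<Prod>i<m. 1 - A * p ^ i)"

(* Meaningful for norm p < 1, where the product converges; prodinf is unspecified otherwise. *)
definition qpoch_inf :: "complex \<Rightarrow> complex \<Rightarrow> complex" where
  "qpoch_inf A p = (\<Prod>i. 1 - A * p ^ i)"

end

theory Submission
  imports Defs
begin

text \<open>Since \<open>(aq;q\<^sup>2)\<^sub>\<infinity> / (aq;q\<^sup>2)\<^sub>j = (aq\<^bsup>2j+1\<^esup>;q\<^sup>2)\<^sub>\<infinity>\<close>, expanding this product by Euler's theorem
  turns the right-hand side into a double series in \<open>a\<close>. After factoring \<open>q ^ n\<^sup>2\<close> out of the coefficients
  of \<open>a\<^sup>n\<close> on both sides (on the left, \<open>2(r+s)\<^sup>2 + 2s\<^sup>2 = (r+2s)\<^sup>2 + r\<^sup>2\<close>), what remains are two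
  convolutions whose generating functions agree.\<close>

section \<open>Finite q-Pochhammer symbols and their coefficient recurrences\<close>

lemma power_neq_1_of_norm_less_1:
  fixes q :: complex
  assumes "norm q < 1" "n > 0"
  shows "q ^ n \<noteq> 1"
proof
  assume "q ^ n = 1"
  then have "norm q ^ n = 1"
    by (metis norm_one norm_power)
  moreover have "norm q ^ n < 1"
    using assms by (simp add: power_less_one_iff)
  ultimately show False
    by simp
qed

lemma qpoch_0 [simp]: "qpoch A p 0 = 1"
  by (simp add: qpoch_def)

lemma qpoch_Suc: "qpoch A p (Suc n) = qpoch A p n * (1 - A * p ^ n)"
  by (simp add: qpoch_def)

lemma qpoch_nonzero:
  assumes "norm p < 1"
  shows "qpoch p p n \<noteq> 0"
proof -
  have "p * p ^ i \<noteq> 1" for i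
    using power_neq_1_of_norm_less_1[OF assms, of "Suc i"] by simp
  then show ?thesis
    by (auto simp: qpoch_def)
qed

text \<open>Coefficient form of \<open>E(p z) = (1 - z) E(z)\<close> for the series
  \<open>E(z)\<close> with coefficients \<open>1 / qpoch p p n\<close>.\<close>

lemma inverse_qpoch:
  assumes "norm p < 1"
  shows "1 / qpoch p p n = 1 / qpoch p p (Suc n) - p ^ Suc n / qpoch p p (Suc n)"
  using qpoch_nonzero[OF assms, of "Suc n"] by (simp add: qpoch_Suc field_simps)

text \<open>Coefficient form of \<open>C(z) = (1 + q z) C(q^2 z)\<close> for the generating function
  of \<open>c\<close>. It serves both the formal convolution identity and, with alternating signs,
  Euler's product expansion.\<close>

lemma theta_qpoch_Suc:
  fixes q :: complex
  assumes "norm q < 1"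
  defines "c \<equiv> \<lambda>n. q ^ n\<^sup>2 / qpoch (q\<^sup>2) (q\<^sup>2) n"
  shows "c (Suc n) = (q\<^sup>2) ^ Suc n * c (Suc n) + q * ((q\<^sup>2) ^ n * c n)"
proof -
  have "norm (q\<^sup>2) < 1"
    using assms(1) by (simp add: norm_power power_less_one_iff)
  moreover have "q * ((q\<^sup>2) ^ n * c n) = q ^ (Suc n)\<^sup>2 * (1 / qpoch (q\<^sup>2) (q\<^sup>2) n)"
    by (simp add: c_def power2_eq_square power_add power_mult_distrib)
  ultimately have "q * ((q\<^sup>2) ^ n * c n) = q ^ (Suc n)\<^sup>2 *
      (1 / qpoch (q\<^sup>2) (q\<^sup>2) (Suc n) - (q\<^sup>2) ^ Suc n / qpoch (q\<^sup>2) (q\<^sup>2) (Suc n))"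
    by (simp only: inverse_qpoch[of "q\<^sup>2" n])
  then show ?thesis
    by (simp add: c_def right_diff_distrib del: power_Suc)
qed

section \<open>Formal power series under the dilation \<open>z -> c z\<close>\<close>

unbundle no vec_syntax and fps_syntax

text \<open>The dilation \<open>f(z) -> f(c z)\<close>. Writing it as a composition makes its
  compatibility with products and differences an instance of the laws for \<open>oo\<close>.\<close>

definition scale_fps :: "complex \<Rightarrow> complex fps \<Rightarrow> complex fps" where
  "scale_fps c f = f oo (fps_const c * fps_X)"

lemma scale_fps_nth [simp]: "scale_fps c f $ n = c ^ n * f $ n"
  by (simp add: scale_fps_def)

lemma scale_fps_mult: "scale_fps c (f * g) = scale_fps c f * scale_fps c g"
  by (simp add: scale_fps_def fps_compose_mult_distrib)

lemma scale_fps_square: "scale_fps (c ^ 2) f = scale_fps c (scale_fps c f)"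
  by (rule fps_ext) (simp add: power2_eq_square power_mult_distrib)

text \<open>In degree \<open>n\<close> the equation for the difference \<open>h\<close> reads
  \<open>(c ^ n - P $ 0) * h $ n\<close> = a combination of lower coefficients of \<open>h\<close>.
  As \<open>P $ 0 = 1\<close> and \<open>c ^ n\<close> is not 1, strong induction makes every
  coefficient vanish.\<close>

lemma scale_fps_unique:
  assumes c: "\<And>n. n > 0 \<Longrightarrow> c ^ n \<noteq> 1"
    and P: "P $ 0 = 1"
    and f: "scale_fps c f = P * f"
    and g: "scale_fps c g = P * g"
    and 0: "f $ 0 = g $ 0"
  shows "f = g"
proof -
  define h where "h = f - g"
  have h: "scale_fps c h = P * h"
    unfolding h_def scale_fps_def fps_compose_sub_distrib
    using f g by (simp add: scale_fps_def algebra_simps)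
  have "h $ n = 0" for n
  proof (induction n rule: less_induct)
    case (less n)
    show ?case
    proof (cases "n = 0")
      case True
      then show ?thesis using 0 by (simp add: h_def)
    next
      case False
      have "c ^ n * h $ n = (\<Sum>i=0..n. P $ i * h $ (n - i))"
        using arg_cong[OF h, of "\<lambda>f. f $ n"] by (simp add: fps_mult_nth)
      also have "\<dots> = P $ 0 * h $ n + (\<Sum>i=1..n. P $ i * h $ (n - i))"
        by (simp add: sum.atLeast_Suc_atMost)
      also have "(\<Sum>i=1..n. P $ i * h $ (n - i)) = 0"
        by (rule sum.neutral) (auto simp: less)
      finally have "(c ^ n - 1) * h $ n = 0"
        using P by (simp add: algebra_simps)
      then show ?thesis
        using c False by simp
    qed
  qed
  then show ?thesis
    by (simp add: h_def fps_eq_iff)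
qed

text \<open>Coefficients of \<open>1 / (z^2;p)_inf\<close>. Padding with zeros at odd indices turns
  sums over \<open>r + 2 * s = n\<close> into ordinary convolutions.\<close>

definition even_coeffs :: "complex \<Rightarrow> nat \<Rightarrow> complex" where
  "even_coeffs p k = (if even k then 1 / qpoch p p (k div 2) else 0)"

text \<open>Both sides are coefficients of \<open>1 / ((z;q)\<^sub>\<infinity> (-z;q\<^sup>2)\<^sub>\<infinity>) = (-zq;q\<^sup>2)\<^sub>\<infinity> / (z\<^sup>2;q\<^sup>2)\<^sub>\<infinity>\<close>; the two
  expressions satisfy the same functional equation under \<open>z \<mapsto> q\<^sup>2 z\<close>.\<close>

lemma qpoch_convolution:
  assumes q: "norm q < 1"
  shows "(\<Sum>i\<le>n. 1 / qpoch q q i * ((-1) ^ (n - i) / qpoch (q\<^sup>2) (q\<^sup>2) (n - i)))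
       = (\<Sum>i\<le>n. q ^ i\<^sup>2 / qpoch (q\<^sup>2) (q\<^sup>2) i * even_coeffs (q\<^sup>2) (n - i))"
proof -
  have q2: "norm (q\<^sup>2) < 1"
    using q by (simp add: norm_power power_less_one_iff)
  \<comment> \<open>Formal counterparts of \<open>1 / (z;q)_inf\<close>,
    \<open>1 / (-z;q^2)_inf\<close>, \<open>(-zq;q^2)_inf\<close> and
    \<open>1 / (z^2;q^2)_inf\<close>, in this order. Only their functional equations and constant
    terms are used.\<close>
  define A where "A = Abs_fps (\<lambda>n. 1 / qpoch q q n)"
  define B where "B = Abs_fps (\<lambda>n. (-1) ^ n / qpoch (q\<^sup>2) (q\<^sup>2) n)"
  define C where "C = Abs_fps (\<lambda>n. q ^ n\<^sup>2 / qpoch (q\<^sup>2) (q\<^sup>2) n)"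
  define D where "D = Abs_fps (even_coeffs (q\<^sup>2))"
  have A: "scale_fps q A = (1 - fps_X) * A"
  proof (rule fps_ext)
    fix n show "scale_fps q A $ n = ((1 - fps_X) * A) $ n"
    proof (cases n)
      case (Suc m)
      then show ?thesis
        by (simp add: A_def left_diff_distrib inverse_qpoch[OF q, of m])
    qed (simp add: A_def)
  qed
  have B: "scale_fps (q\<^sup>2) B = (1 + fps_X) * B"
  proof (rule fps_ext)
    fix n show "scale_fps (q\<^sup>2) B $ n = ((1 + fps_X) * B) $ n"
    proof (cases n)
      case (Suc m)
      have "(-1) ^ m / qpoch (q\<^sup>2) (q\<^sup>2) m = (-1) ^ m * (1 / qpoch (q\<^sup>2) (q\<^sup>2) m)"
        by simp
      with Suc show ?thesis
        unfolding inverse_qpoch[OF q2, of m] by (simp add: B_def distrib_right right_diff_distrib)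
    qed (simp add: B_def)
  qed
  have C: "C = (1 + fps_const q * fps_X) * scale_fps (q\<^sup>2) C"
  proof (rule fps_ext)
    fix n show "C $ n = ((1 + fps_const q * fps_X) * scale_fps (q\<^sup>2) C) $ n"
    proof (cases n)
      case (Suc m)
      have "C $ Suc m = (q\<^sup>2) ^ Suc m * C $ Suc m + q * ((q\<^sup>2) ^ m * C $ m)"
        unfolding C_def fps_nth_Abs_fps by (rule theta_qpoch_Suc[OF q])
      also have "\<dots> = ((1 + fps_const q * fps_X) * scale_fps (q\<^sup>2) C) $ n"
        by (simp add: Suc distrib_right mult.assoc)
      finally show ?thesis
        by (simp only: Suc)
    qed (simp add: C_def)
  qed
  have D: "scale_fps q D = (1 - fps_X\<^sup>2) * D"
  proof (rule fps_ext)
    fix n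
    consider "n = 0" | "n = 1" | m where "n = Suc (Suc m)"
      by (metis One_nat_def not0_implies_Suc)
    then show "scale_fps q D $ n = ((1 - fps_X\<^sup>2) * D) $ n"
    proof cases
      case 3
      \<comment> \<open>In even degree this reduces the claim to \<open>inverse_qpoch\<close> at
        \<open>m div 2\<close>; in odd degree both sides are 0.\<close>
      have "q ^ n = (q\<^sup>2) ^ Suc (m div 2)" if "even m"
        using that 3 by (auto elim!: evenE simp: power_mult power_add power2_eq_square power_mult_distrib)
      then show ?thesis
        using 3 by (simp add: D_def even_coeffs_def left_diff_distrib fps_X_power_mult_nth
            inverse_qpoch[OF q2, of "m div 2"])
    qed (simp_all add: D_def even_coeffs_def left_diff_distrib fps_X_power_mult_nth)
  qed
  have s1: "scale_fps q (1 - fps_X) = 1 - fps_const q * fps_X"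
    by (rule fps_ext) (simp add: fps_X_def)
  have s2: "scale_fps q (1 - fps_X\<^sup>2) = 1 - (fps_const q * fps_X)\<^sup>2"
    by (rule fps_ext) (auto simp: power_mult_distrib fps_X_power_nth)
  \<comment> \<open>Dilating \<open>A\<close> twice by \<open>q\<close> gives
    \<open>(1 - q z) (1 - z)\<close>, and \<open>B\<close> contributes \<open>1 + z\<close>; the
    product is \<open>P\<close>.\<close>
  define P where "P = (1 - fps_const q * fps_X) * (1 - fps_X\<^sup>2)"
  have AB: "scale_fps (q\<^sup>2) (A * B) = P * (A * B)"
    unfolding scale_fps_mult B unfolding scale_fps_square A unfolding scale_fps_mult A s1
    by (simp add: P_def power2_eq_square algebra_simps)
  have D2: "scale_fps (q\<^sup>2) D = (1 - (fps_const q * fps_X)\<^sup>2) * (1 - fps_X\<^sup>2) * D"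
    unfolding scale_fps_square D unfolding scale_fps_mult D s2 by (simp add: mult.assoc)
  \<comment> \<open>The equation for \<open>C\<close> has its factor on the dilated side. It is
    multiplied through here and cancelled below, using
    \<open>1 - q^2 z^2 = (1 + q z) (1 - q z)\<close>.\<close>
  have "(1 + fps_const q * fps_X) * scale_fps (q\<^sup>2) (C * D)
      = C * ((1 - (fps_const q * fps_X)\<^sup>2) * (1 - fps_X\<^sup>2) * D)"
    unfolding scale_fps_mult D2 by (subst (2) C) (simp only: mult.assoc)
  also have "\<dots> = (1 + fps_const q * fps_X) * (P * (C * D))"
    unfolding P_def by (simp only: power2_eq_square) algebra
  finally have *: "(1 + fps_const q * fps_X) * scale_fps (q\<^sup>2) (C * D)
      = (1 + fps_const q * fps_X) * (P * (C * D))" .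
  have "(1 + fps_const q * fps_X) $ 0 \<noteq> 0"
    by simp
  then have "1 + fps_const q * fps_X \<noteq> 0"
    by (metis fps_zero_nth)
  with * have CD: "scale_fps (q\<^sup>2) (C * D) = P * (C * D)"
    by (metis mult_left_cancel)
  have "A * B = C * D"
    by (rule scale_fps_unique[OF _ _ AB CD])
      (use power_neq_1_of_norm_less_1[OF q2] in
        \<open>auto simp: P_def A_def B_def C_def D_def even_coeffs_def\<close>)
  from arg_cong[OF this, of "\<lambda>f. f $ n"] show ?thesis
    by (simp add: fps_mult_nth A_def B_def C_def D_def atMost_atLeast0)
qed

section \<open>Absolute convergence and rearrangement of the double series\<close>

text \<open>Consecutive terms have ratio \<open>a * q ^ (2 * n + 1) / (1 - p ^ Suc n)\<close>, which
  tends to 0. The independent bases \<open>q\<close> and \<open>p\<close> cover all four series of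
  the final proof.\<close>

lemma summable_theta_qpoch:
  fixes a :: complex
  assumes q: "norm q < 1" and p: "norm p < 1"
  shows "summable (\<lambda>n. norm (a ^ n * q ^ n\<^sup>2 / qpoch p p n))"
proof -
  define f where "f n = norm (a ^ n * q ^ n\<^sup>2 / qpoch p p n)" for n
  define r where "r n = norm (a * (q * (q\<^sup>2) ^ n) / (1 - p ^ Suc n))" for n
  have f: "f (Suc n) = r n * f n" for n
  proof -
    have "q ^ (Suc n)\<^sup>2 = q * (q\<^sup>2) ^ n * q ^ n\<^sup>2"
      by (simp add: power2_eq_square power_add power_mult_distrib)
    then show ?thesis
      by (simp add: f_def r_def qpoch_Suc norm_mult norm_divide mult_ac)
  qed
  have "norm (q\<^sup>2) < 1"
    using q by (simp add: norm_power power_less_one_iff)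
  then have "r \<longlonglongrightarrow> norm (a * (q * 0) / (1 - 0))"
    unfolding r_def using p
    by (intro tendsto_intros LIMSEQ_Suc[OF LIMSEQ_power_zero] LIMSEQ_power_zero) auto
  then have "eventually (\<lambda>n. r n < 1 / 2) sequentially"
    by (intro order_tendstoD) auto
  then obtain N where N: "\<And>n. n \<ge> N \<Longrightarrow> r n < 1 / 2"
    by (auto simp: eventually_sequentially)
  have "summable f"
  proof (rule summable_ratio_test[of "1 / 2" N])
    fix n assume "n \<ge> N"
    with N show "norm (f (Suc n)) \<le> 1 / 2 * norm (f n)"
      unfolding f norm_mult by (intro mult_right_mono) (auto simp: r_def less_imp_le)
  qed simp
  then show ?thesis
    unfolding f_def .
qed

text \<open>A Cauchy product twisted by \<open>q ^ (i + k)\<^sup>2\<close>; the cross factor \<open>q ^ (2 * i * k)\<close> only helps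
  convergence.\<close>

lemma twisted_Cauchy_product:
  fixes a q :: complex and x y :: "nat \<Rightarrow> complex"
  assumes q: "norm q \<le> 1"
    and x: "summable (\<lambda>n. norm (a ^ n * q ^ n\<^sup>2 * x n))"
    and y: "summable (\<lambda>n. norm (a ^ n * q ^ n\<^sup>2 * y n))"
  defines "F \<equiv> \<lambda>i k. a ^ (i + k) * q ^ (i + k)\<^sup>2 * (x i * y k)"
  shows "summable (F i)"
    and "(\<lambda>i. \<Sum>k. F i k) sums (\<Sum>n. a ^ n * q ^ n\<^sup>2 * (\<Sum>i\<le>n. x i * y (n - i)))"
proof -
  define u where "u n = a ^ n * q ^ n\<^sup>2 * x n" for n
  define v where "v n = a ^ n * q ^ n\<^sup>2 * y n" for n
  have u: "(\<lambda>n. norm (u n)) summable_on UNIV" and v: "(\<lambda>n. norm (v n)) summable_on UNIV"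
    using x y by (auto intro!: norm_summable_imp_summable_on simp: u_def v_def)
  have "(\<lambda>ik. norm ((\<lambda>(i, k). u i * v k) ik)) summable_on Sigma UNIV (\<lambda>_. UNIV)"
    unfolding Infinite_Sum.abs_summable_on_Sigma_iff
    using u v by (auto simp: norm_mult infsum_cmult_right' abs_mult
        intro!: summable_on_cmult_right summable_on_cmult_left)
  then have "(\<lambda>ik. norm ((\<lambda>(i, k). F i k) ik)) summable_on Sigma UNIV (\<lambda>_. UNIV)"
  proof (rule Infinite_Sum.abs_summable_on_comparison_test)
    fix ik :: "nat \<times> nat"
    obtain i k where ik: "ik = (i, k)"
      by force
    have "(i + k)\<^sup>2 = i\<^sup>2 + k\<^sup>2 + 2 * i * k"
      by (simp add: power2_sum)
    then have "F i k = u i * v k * q ^ (2 * i * k)"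
      by (simp add: F_def u_def v_def power_add mult_ac)
    moreover have "norm (q ^ (2 * i * k)) \<le> 1"
      using q by (simp add: norm_power power_le_one)
    ultimately show "norm (case ik of (i, k) \<Rightarrow> F i k) \<le> norm (case ik of (i, k) \<Rightarrow> u i * v k)"
      by (simp add: ik norm_mult mult_left_le)
  qed
  then have "(\<lambda>(i, k). F i k) summable_on Sigma UNIV (\<lambda>_. UNIV)"
    by (rule abs_summable_summable)
  then obtain S where S: "((\<lambda>(i, k). F i k) has_sum S) (Sigma UNIV (\<lambda>_. UNIV))"
    by (auto simp: summable_on_def)
  have row: "(F i) summable_on UNIV" for i
    using summable_on_SigmaD1[of F UNIV "\<lambda>_. UNIV" i] S
    by (auto simp: summable_on_def)
  then show "summable (F i)" for i
    by (rule summable_on_imp_summable)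
  have "((\<lambda>k. F i k) has_sum (\<Sum>k. F i k)) UNIV" for i
    using row[of i] by (metis has_sum_imp_sums has_sum_infsum sums_unique)
  then have "((\<lambda>i. \<Sum>k. F i k) has_sum S) UNIV"
    by (intro has_sum_SigmaD[OF S]) auto
  then have rows: "(\<lambda>i. \<Sum>k. F i k) sums S"
    by (rule has_sum_imp_sums)
  \<comment> \<open>The same unconditional sum, now grouped by antidiagonals
    \<open>i + k = n\<close>.\<close>
  have "((\<lambda>(n, i). F i (n - i)) has_sum S) (Sigma UNIV (\<lambda>n. {..n}))"
    by (rule iffD2[OF has_sum_reindex_bij_witness[where
            j = "\<lambda>(n, i). (i, n - i)" and i = "\<lambda>(i, k). (i + k, i)"] S]) auto
  then have "((\<lambda>n. \<Sum>i\<le>n. F i (n - i)) has_sum S) UNIV"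
    by (rule has_sum_SigmaD) auto
  then have "(\<lambda>n. \<Sum>i\<le>n. F i (n - i)) sums S"
    by (rule has_sum_imp_sums)
  moreover have "(\<Sum>i\<le>n. F i (n - i)) = a ^ n * q ^ n\<^sup>2 * (\<Sum>i\<le>n. x i * y (n - i))" for n
    unfolding sum_distrib_left by (rule sum.cong) (auto simp: F_def)
  ultimately show "(\<lambda>i. \<Sum>k. F i k) sums (\<Sum>n. a ^ n * q ^ n\<^sup>2 * (\<Sum>i\<le>n. x i * y (n - i)))"
    using rows by (simp add: sums_iff)
qed

section \<open>Infinite products and Euler's expansion\<close>

lemma convergent_prod_qpoch:
  fixes A p :: complex
  assumes "norm p < 1"
  shows "convergent_prod (\<lambda>i. 1 - A * p ^ i)"
proof (intro abs_convergent_prod_imp_convergent_prod summable_imp_abs_convergent_prod)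
  show "summable (\<lambda>i. norm (1 - A * p ^ i - 1))"
    using assms by (auto simp: norm_mult norm_power intro!: summable_mult summable_geometric)
qed

lemma qpoch_LIMSEQ:
  assumes "norm p < 1"
  shows "qpoch A p \<longlonglongrightarrow> qpoch_inf A p"
  using convergent_prod_LIMSEQ[OF convergent_prod_qpoch[OF assms, of A]]
  by (simp add: qpoch_def[abs_def] qpoch_inf_def LIMSEQ_lessThan_iff_atMost)

lemma qpoch_inf_split:
  assumes "norm p < 1"
  shows "qpoch_inf A p = qpoch A p j * qpoch_inf (A * p ^ j) p"
proof (rule LIMSEQ_unique)
  show "(\<lambda>n. qpoch A p (j + n)) \<longlonglongrightarrow> qpoch_inf A p"
    using LIMSEQ_ignore_initial_segment[OF qpoch_LIMSEQ[OF assms, of A], of j]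
    by (simp add: add.commute)
  have "qpoch A p (j + n) = qpoch A p j * qpoch (A * p ^ j) p n" for n
    by (induction n) (simp_all add: qpoch_Suc power_add mult_ac)
  then show "(\<lambda>n. qpoch A p (j + n)) \<longlonglongrightarrow> qpoch A p j * qpoch_inf (A * p ^ j) p"
    by (simp add: tendsto_mult_left qpoch_LIMSEQ[OF assms])
qed

text \<open>The series \<open>K\<close> satisfies \<open>K y = (1 - y * q) * K (y * q^2)\<close>.
  Iterating splits off the finite products, while the remaining argument tends to 0, where
  \<open>K\<close> is continuous with value 1.\<close>

lemma Euler_qpoch_inf:
  assumes q: "norm q < 1"
  shows "(\<lambda>m. (-1) ^ m * q ^ m\<^sup>2 / qpoch (q\<^sup>2) (q\<^sup>2) m * y ^ m) sums qpoch_inf (y * q) (q\<^sup>2)"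
proof -
  have q2: "norm (q\<^sup>2) < 1"
    using q by (simp add: norm_power power_less_one_iff)
  define c where "c m = (-1) ^ m * q ^ m\<^sup>2 / qpoch (q\<^sup>2) (q\<^sup>2) m" for m
  define K where "K y = (\<Sum>m. c m * y ^ m)" for y
  have summ: "summable (\<lambda>m. c m * y ^ m)" for y
  proof (rule summable_norm_cancel)
    show "summable (\<lambda>m. norm (c m * y ^ m))"
      using summable_theta_qpoch[OF q q2, of y]
      by (simp add: c_def norm_mult norm_divide norm_power mult_ac)
  qed
  have c_Suc: "c (Suc m) = (q\<^sup>2) ^ Suc m * c (Suc m) - q * ((q\<^sup>2) ^ m * c m)" for m
  proof -
    define d where "d m = q ^ m\<^sup>2 / qpoch (q\<^sup>2) (q\<^sup>2) m" for m
    have "d (Suc m) = (q\<^sup>2) ^ Suc m * d (Suc m) + q * ((q\<^sup>2) ^ m * d m)"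
      unfolding d_def by (rule theta_qpoch_Suc[OF q])
    then have "(-1) ^ Suc m * d (Suc m)
        = (-1) ^ Suc m * ((q\<^sup>2) ^ Suc m * d (Suc m) + q * ((q\<^sup>2) ^ m * d m))"
      by (rule arg_cong)
    moreover have "c n = (-1) ^ n * d n" for n
      by (simp add: c_def d_def)
    ultimately show ?thesis
      by (simp add: algebra_simps)
  qed
  have K: "K y = (1 - y * q) * K (y * q\<^sup>2)" for y
  proof -
    have s: "summable (\<lambda>m. c m * (y * q\<^sup>2) ^ m)"
      by (rule summ)
    have "K y = c 0 + (\<Sum>m. c (Suc m) * y ^ Suc m)"
      unfolding K_def using suminf_split_head[OF summ, of y] by simp
    also have "(\<lambda>m. c (Suc m) * y ^ Suc m)
        = (\<lambda>m. c (Suc m) * (y * q\<^sup>2) ^ Suc m - y * q * (c m * (y * q\<^sup>2) ^ m))"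
      by (subst c_Suc) (simp add: fun_eq_iff power_mult_distrib algebra_simps)
    also have "suminf \<dots> = (\<Sum>m. c (Suc m) * (y * q\<^sup>2) ^ Suc m) - y * q * K (y * q\<^sup>2)"
      unfolding K_def suminf_mult[OF s, symmetric]
      by (rule suminf_diff[symmetric])
        (use s in \<open>auto intro!: summable_mult simp del: power_Suc
            simp: summable_Suc_iff[of "\<lambda>m. c m * (y * q\<^sup>2) ^ m"]\<close>)
    also have "c 0 + \<dots> = K (y * q\<^sup>2) - y * q * K (y * q\<^sup>2)"
      unfolding K_def using suminf_split_head[OF s] by simp
    finally show ?thesis
      by (simp add: algebra_simps)
  qed
  have iter: "K y = qpoch (y * q) (q\<^sup>2) n * K (y * (q\<^sup>2) ^ n)" for n
  proof (induction n)
    case (Suc n)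
    then show ?case
      using K[of "y * (q\<^sup>2) ^ n"] by (simp add: qpoch_Suc mult_ac)
  qed simp
  have "isCont K 0"
    unfolding K_def[abs_def] by (rule isCont_powser_converges_everywhere[OF summ])
  moreover have "(\<lambda>n. y * (q\<^sup>2) ^ n) \<longlonglongrightarrow> 0"
    using tendsto_mult_right_zero[OF LIMSEQ_power_zero[OF q2]] by simp
  ultimately have "(\<lambda>n. K (y * (q\<^sup>2) ^ n)) \<longlonglongrightarrow> K 0"
    by (rule isCont_tendsto_compose)
  then have "(\<lambda>n. qpoch (y * q) (q\<^sup>2) n * K (y * (q\<^sup>2) ^ n)) \<longlonglongrightarrow> qpoch_inf (y * q) (q\<^sup>2) * K 0"
    by (intro tendsto_mult qpoch_LIMSEQ[OF q2])
  then have "K y = qpoch_inf (y * q) (q\<^sup>2) * K 0"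
    unfolding iter[symmetric] by (simp add: LIMSEQ_const_iff)
  moreover have "K 0 = 1"
    unfolding K_def by (subst powser_zero) (simp add: c_def)
  ultimately have "K y = qpoch_inf (y * q) (q\<^sup>2)"
    by simp
  then show ?thesis
    using summ[of y] unfolding K_def c_def by (simp add: sums_iff)
qed

theorem corollary2p2:
  fixes q a :: complex
  assumes "norm q < 1"
    and "\<And>i::nat. a * q ^ (2 * i + 1) \<noteq> 1"
  shows
    "convergent_prod (\<lambda>i. 1 - (a * q) * (q ^ 2) ^ i) \<and>
     (\<forall>r. summable (\<lambda>s. a ^ (r + 2 * s) * q ^ (2 * (r + s) ^ 2 + 2 * s ^ 2)
        / (qpoch (q ^ 2) (q ^ 2) r * qpoch (q ^ 2) (q ^ 2) s))) \<and>
     summable (\<lambda>r. \<Sum>s. a ^ (r + 2 * s) * q ^ (2 * (r + s) ^ 2 + 2 * s ^ 2)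
        / (qpoch (q ^ 2) (q ^ 2) r * qpoch (q ^ 2) (q ^ 2) s)) \<and>
     summable (\<lambda>j. a ^ j * q ^ (j ^ 2) / (qpoch (a * q) (q ^ 2) j * qpoch q q j)) \<and>
     (\<Sum>r. \<Sum>s. a ^ (r + 2 * s) * q ^ (2 * (r + s) ^ 2 + 2 * s ^ 2)
        / (qpoch (q ^ 2) (q ^ 2) r * qpoch (q ^ 2) (q ^ 2) s))
      = qpoch_inf (a * q) (q ^ 2)
        * (\<Sum>j. a ^ j * q ^ (j ^ 2) / (qpoch (a * q) (q ^ 2) j * qpoch q q j))"
proof -
  note q = assms(1)
  have q2: "norm (q\<^sup>2) < 1" and q4: "norm (q ^ 4) < 1"
    using q by (simp_all add: norm_power power_less_one_iff)
  have conv: "convergent_prod (\<lambda>i. 1 - (a * q) * (q ^ 2) ^ i)"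
    by (rule convergent_prod_qpoch[OF q2])
  have factor_nonzero: "1 - (a * q) * (q\<^sup>2) ^ i \<noteq> 0" for i
    using assms(2)[of i] by (simp add: power_mult mult.assoc)
  then have inf_nonzero: "qpoch_inf (a * q) (q\<^sup>2) \<noteq> 0"
    unfolding qpoch_inf_def by (rule prodinf_nonzero[OF conv])
  have fin_nonzero: "qpoch (a * q) (q\<^sup>2) j \<noteq> 0" for j
    using factor_nonzero by (simp add: qpoch_def)

  define f where "f r s = a ^ (r + 2 * s) * q ^ (2 * (r + s) ^ 2 + 2 * s ^ 2)
        / (qpoch (q ^ 2) (q ^ 2) r * qpoch (q ^ 2) (q ^ 2) s)" for r s
  define g where "g j = a ^ j * q ^ (j ^ 2) / (qpoch (a * q) (q ^ 2) j * qpoch q q j)" for j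
  define C where "C r = q ^ r\<^sup>2 / qpoch (q\<^sup>2) (q\<^sup>2) r" for r
  define D where "D = even_coeffs (q\<^sup>2)"
  define A where "A j = 1 / qpoch q q j" for j
  define B where "B m = (-1) ^ m / qpoch (q\<^sup>2) (q\<^sup>2) m" for m
  define F where "F r k = a ^ (r + k) * q ^ (r + k)\<^sup>2 * (C r * D k)" for r k
  define G where "G j m = a ^ (j + m) * q ^ (j + m)\<^sup>2 * (A j * B m)" for j m
  define T where "T = (\<Sum>n. a ^ n * q ^ n\<^sup>2 * (\<Sum>i\<le>n. C i * D (n - i)))"

  have mono: "strict_mono (\<lambda>s::nat. 2 * s)"
    by (simp add: strict_mono_def)
  have D_even: "D (2 * s) = 1 / qpoch (q\<^sup>2) (q\<^sup>2) s" for s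
    by (simp add: D_def even_coeffs_def)
  have D_odd: "D k = 0" if "k \<notin> range (\<lambda>s::nat. 2 * s)" for k
    using that by (auto simp: D_def even_coeffs_def elim!: evenE)
  \<comment> \<open>\<open>C n\<close> carries a second factor \<open>q ^ n\<^sup>2\<close>, hence
    the theta base \<open>q^2\<close>.\<close>
  have C_summable: "summable (\<lambda>n. norm (a ^ n * q ^ n\<^sup>2 * C n))"
    using summable_theta_qpoch[OF q2 q2, of a]
    by (simp add: C_def power2_eq_square power_mult_distrib mult_ac)
  \<comment> \<open>At even indices the terms form a theta series in \<open>a^2\<close> with base
    \<open>q^4\<close>, since \<open>(2 * s)^2 = 4 * s^2\<close>.\<close>
  have "summable (\<lambda>s. norm (a ^ (2 * s) * q ^ (2 * s)\<^sup>2 * D (2 * s)))"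
    using summable_theta_qpoch[OF q4 q2, of "a\<^sup>2"]
    by (simp add: D_even power_mult power_mult_distrib)
  then have D_summable: "summable (\<lambda>n. norm (a ^ n * q ^ n\<^sup>2 * D n))"
    by (subst (asm) summable_mono_reindex[OF mono]) (auto simp: D_odd)
  have A_summable: "summable (\<lambda>n. norm (a ^ n * q ^ n\<^sup>2 * A n))"
    using summable_theta_qpoch[OF q q, of a] by (simp add: A_def)
  have B_summable: "summable (\<lambda>n. norm (a ^ n * q ^ n\<^sup>2 * B n))"
    using summable_theta_qpoch[OF q q2, of a] by (simp add: B_def norm_mult norm_divide norm_power)

  have f_eq: "f r s = F r (2 * s)" for r s
  proof -
    have "2 * (r + s)\<^sup>2 + 2 * s\<^sup>2 = (r + 2 * s)\<^sup>2 + r\<^sup>2"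
      by (simp add: power2_eq_square algebra_simps)
    then show ?thesis
      unfolding f_def F_def C_def D_even by (simp add: power_add)
  qed
  have F_odd: "F r k = 0" if "k \<notin> range (\<lambda>s::nat. 2 * s)" for r k
    using D_odd[OF that] by (simp add: F_def)
  have F_row: "summable (F r)" for r
    unfolding F_def
    by (rule twisted_Cauchy_product(1)[OF less_imp_le[OF q] C_summable D_summable])
  have f_row: "summable (f r)" for r
    using summable_mono_reindex[OF mono, of "F r"] F_odd F_row by (simp add: f_eq[abs_def])
  have f_sum: "(\<Sum>s. f r s) = (\<Sum>k. F r k)" for r
    using suminf_mono_reindex[OF mono, of "F r"] F_odd by (simp add: f_eq)
  have f_sums: "(\<lambda>r. \<Sum>s. f r s) sums T"
    unfolding f_sum F_def T_def
    by (rule twisted_Cauchy_product(2)[OF less_imp_le[OF q] C_summable D_summable])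

  have "(\<Sum>m. G j m) = qpoch_inf (a * q) (q\<^sup>2) * g j" for j
  proof -
    \<comment> \<open>The cross factor \<open>q ^ (2 * j * m)\<close> is absorbed into the
      \<open>m\<close>-th power, so the inner sum is Euler's expansion at
      \<open>y = a * q ^ (2 * j)\<close>.\<close>
    have G: "G j m = a ^ j * q ^ j\<^sup>2 / qpoch q q j
        * ((-1) ^ m * q ^ m\<^sup>2 / qpoch (q\<^sup>2) (q\<^sup>2) m * (a * (q\<^sup>2) ^ j) ^ m)" for m
    proof -
      have "q ^ (j + m)\<^sup>2 = q ^ j\<^sup>2 * q ^ m\<^sup>2 * ((q\<^sup>2) ^ j) ^ m"
        by (simp add: power2_sum power_add flip: power_mult)
      then show ?thesis
        by (simp add: G_def A_def B_def power_add power_mult_distrib)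
    qed
    have "(\<lambda>m. G j m) sums
        (a ^ j * q ^ j\<^sup>2 / qpoch q q j * qpoch_inf (a * (q\<^sup>2) ^ j * q) (q\<^sup>2))"
      unfolding G by (rule sums_mult[OF Euler_qpoch_inf[OF q]])
    moreover have "qpoch_inf (a * q) (q\<^sup>2)
        = qpoch (a * q) (q\<^sup>2) j * qpoch_inf (a * (q\<^sup>2) ^ j * q) (q\<^sup>2)"
      using qpoch_inf_split[OF q2, of "a * q" j] by (simp add: mult_ac)
    ultimately show ?thesis
      using fin_nonzero[of j] by (simp add: sums_iff g_def)
  qed
  moreover have "(\<lambda>j. \<Sum>m. G j m) sums (\<Sum>n. a ^ n * q ^ n\<^sup>2 * (\<Sum>i\<le>n. A i * B (n - i)))"
    unfolding G_def
    by (rule twisted_Cauchy_product(2)[OF less_imp_le[OF q] A_summable B_summable])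
  moreover have "(\<Sum>i\<le>n. A i * B (n - i)) = (\<Sum>i\<le>n. C i * D (n - i))" for n
    unfolding A_def B_def C_def D_def by (rule qpoch_convolution[OF q])
  ultimately have g_sums: "(\<lambda>j. qpoch_inf (a * q) (q\<^sup>2) * g j) sums T"
    by (simp add: T_def)
  \<comment> \<open>The infinite product is nonzero because none of its factors vanishes, so it can
    be divided off.\<close>
  then have g_summable: "summable g"
    using inf_nonzero by (auto dest: sums_summable simp: summable_cmult_iff)
  have "(\<Sum>r. \<Sum>s. f r s) = qpoch_inf (a * q) (q\<^sup>2) * (\<Sum>j. g j)"
    using f_sums g_sums suminf_mult[OF g_summable] by (simp add: sums_iff)
  with conv f_row f_sums g_summable show ?thesis
    unfolding f_def g_def by (auto simp: sums_iff)
qed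

end
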